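(* Let $M$ be a given positive constant and let $\lambda$ be any positive number. Then there exist $$(v,p,\theta)\in C(T^3\times[0,1];\mathbb{R}^3\times\mathbb{R}\times\mathbb{R})$$ which solve the Boussinesq system without heat source $$\begin{cases} v_t+\operatorname{div}(v\otimes v)+\nabla p=\theta e_3,\\ \operatorname{div}v=0,\\ \theta_t+\operatorname{div}(v\theta)=0,\end{cases}\qquad\text{in }T^3\times[0,1],$$ in the sense of distributions, and satisfy $$\sup_{x\in T^3}|v(x,0)|\le 4M,\qquad \int_0^1\!\!\int_{T^3}|\theta|^2(x,t)\,dx\,dt\ge\lambda^2,$$ $$\sup_{x\in T^3}|v(x,t)|\ge\lambda,\qquad \inf_{x\in T^3}|v(x,t)|\le 4M,\qquad\forall t\in[\tfrac12,1].$$
   Context: $T^3=S^1\times S^1\times S^1$ is the 3-dimensional torus (functions on $T^3$ are $2\pi$-periodic in each variable), and $e_3=(0,0,1)^T$. $(v,p,\theta)$ solves the Boussinesq system with heat source $h$ in the sense of distributions if $$\int_0^1\!\!\int_{T^3}(\partial_t\varphi\cdot v+\nabla\varphi:v\otimes v+p\operatorname{div}\varphi+\theta e_3\cdot\varphi)\,dx\,dt=0\quad\forall\varphi\in C_c^\infty(T^3\times(0,1);\mathbb{R}^3),$$ $$\int_0^1\!\!\int_{T^3}(\partial_t\phi\,\theta+v\cdot\nabla\phi\,\theta+h\phi)\,dx\,dt=0\quad\forall\phi\in C_c^\infty(T^3\times(0,1);\mathbb{R}),$$ $$\int_0^1\!\!\int_{T^3}v\cdot\nabla\psi\,dx\,dt=0\quad\forall\psi\in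 C_c^\infty(T^3\times(0,1);\mathbb{R}).$$ Here $h=0$. *)

theory Defs
  imports "HOL-Analysis.Analysis"
begin

text \<open>
  Functions on the torus are represented by functions on \<open>real ^ 3\<close> that are
  \<open>2 * pi\<close>-periodic in each variable. The closed cube \<open>T3\<close> contains a representative of
  every point of the torus and is a fundamental domain up to a null set, so suprema, infima
  and (unnormalised) integrals over the torus are taken over \<open>T3\<close>.
  Space-time points are pairs \<open>(x, t)\<close>.
\<close>

definition T3 :: "(real ^ 3) set" where
  "T3 = {x. \<forall>i. 0 \<le> x $ i \<and> x $ i \<le> 2 * pi}"

definition e3 :: "real ^ 3" where
  "e3 = axis 3 1"

definition torus_periodic :: "(real ^ 3 \<Rightarrow> 'b) \<Rightarrow> bool" where
  "torus_periodic f \<longleftrightarrow> (\<forall>x i. f (x + axis i (2 * pi)) = f x)"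

text \<open>The space \<open>C(T\<^sup>3 \<times> [0,1])\<close>; values at times outside \<open>[0,1]\<close> are irrelevant.\<close>

definition continuous_T3 :: "((real ^ 3) \<times> real \<Rightarrow> 'b::topological_space) \<Rightarrow> bool" where
  "continuous_T3 f \<longleftrightarrow>
     continuous_on (UNIV \<times> {0..1}) f \<and> (\<forall>t\<in>{0..1}. torus_periodic (\<lambda>x. f (x, t)))"

text \<open>\<open>C_k k f\<close>: all iterated partial derivatives of \<open>f\<close> up to order \<open>k\<close> exist and are
  continuous.\<close>

primrec C_k :: "nat \<Rightarrow> ('a::euclidean_space \<Rightarrow> 'b::real_normed_vector) \<Rightarrow> bool" where
  "C_k 0 f \<longleftrightarrow> continuous_on UNIV f"
| "C_k (Suc k) f \<longleftrightarrow> f differentiable_on UNIV \<and>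
     (\<forall>b\<in>Basis. C_k k (\<lambda>x. frechet_derivative f (at x) b))"

definition smooth :: "('a::euclidean_space \<Rightarrow> 'b::real_normed_vector) \<Rightarrow> bool" where
  "smooth f \<longleftrightarrow> (\<forall>k. C_k k f)"

text \<open>
  Test functions, i.e. \<open>C\<^sub>c\<^sup>\<infinity>(T\<^sup>3 \<times> (0,1))\<close>, extended by zero to all times. As the torus is
  compact, compact support in \<open>T\<^sup>3 \<times> (0,1)\<close> only restricts the time variable.
\<close>

definition test_function :: "((real ^ 3) \<times> real \<Rightarrow> 'b::real_normed_vector) \<Rightarrow> bool" where
  "test_function f \<longleftrightarrow> smooth f \<and> (\<forall>t. torus_periodic (\<lambda>x. f (x, t))) \<and>
     (\<exists>a b. 0 < a \<and> b < 1 \<and> (\<forall>x t. t \<notin> {a..b} \<longrightarrow> f (x, t) = 0))"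

definition dt :: "((real ^ 3) \<times> real \<Rightarrow> 'b::real_normed_vector) \<Rightarrow> (real ^ 3) \<times> real \<Rightarrow> 'b" where
  "dt f = (\<lambda>(x, t). vector_derivative (\<lambda>s. f (x, s)) (at t))"

definition grad :: "((real ^ 3) \<times> real \<Rightarrow> real) \<Rightarrow> (real ^ 3) \<times> real \<Rightarrow> real ^ 3" where
  "grad f = (\<lambda>(x, t). \<chi> i. frechet_derivative (\<lambda>y. f (y, t)) (at x) (axis i 1))"

definition Grad :: "((real ^ 3) \<times> real \<Rightarrow> real ^ 3) \<Rightarrow> (real ^ 3) \<times> real \<Rightarrow> real ^ 3 ^ 3" where
  "Grad f = (\<lambda>(x, t). jacobian (\<lambda>y. f (y, t)) (at x))"

definition divergence :: "((real ^ 3) \<times> real \<Rightarrow> real ^ 3) \<Rightarrow> (real ^ 3) \<times> real \<Rightarrow> real" where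
  "divergence f z = trace (Grad f z)"

definition tensor :: "real ^ 3 \<Rightarrow> real ^ 3 \<Rightarrow> real ^ 3 ^ 3" where
  "tensor u w = (\<chi> i j. u $ i * w $ j)"

definition spacetime_integral :: "((real ^ 3) \<times> real \<Rightarrow> real) \<Rightarrow> real" where
  "spacetime_integral f = (LINT t:{0..1}|lborel. (LINT x:T3|lborel. f (x, t)))"

text \<open>
  Distributional solutions of the Boussinesq system with heat source \<open>h\<close>. The inner product
  on \<open>real ^ 3 ^ 3\<close> is the Frobenius product \<open>A : B\<close>.
\<close>

definition boussinesq_solution ::
  "((real ^ 3) \<times> real \<Rightarrow> real) \<Rightarrow> ((real ^ 3) \<times> real \<Rightarrow> real ^ 3) \<Rightarrow>
   ((real ^ 3) \<times> real \<Rightarrow> real) \<Rightarrow> ((real ^ 3) \<times> real \<Rightarrow> real) \<Rightarrow> bool" where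
  "boussinesq_solution h v p \<theta> \<longleftrightarrow>
     (\<forall>\<phi> :: (real ^ 3) \<times> real \<Rightarrow> real ^ 3. test_function \<phi> \<longrightarrow>
        spacetime_integral (\<lambda>z. dt \<phi> z \<bullet> v z + Grad \<phi> z \<bullet> tensor (v z) (v z)
          + p z * divergence \<phi> z + (\<theta> z *\<^sub>R e3) \<bullet> \<phi> z) = 0) \<and>
     (\<forall>\<phi> :: (real ^ 3) \<times> real \<Rightarrow> real. test_function \<phi> \<longrightarrow>
        spacetime_integral (\<lambda>z. dt \<phi> z * \<theta> z + (v z \<bullet> grad \<phi> z) * \<theta> z + h z * \<phi> z) = 0) \<and>
     (\<forall>\<psi> :: (real ^ 3) \<times> real \<Rightarrow> real. test_function \<psi> \<longrightarrow>
        spacetime_integral (\<lambda>z. v z \<bullet> grad \<psi> z) = 0)"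

end

theory Submission
  imports Defs
begin

text \<open>
  No convex integration is needed: for any periodic \<open>g\<close> not depending on \<open>x\<^sub>3\<close>, the vertical
  shear flow \<open>v = t g e\<^sub>3\<close> with \<open>p = 0\<close> and \<open>\<theta> = g\<close> solves the system, since \<open>v \<cdot> \<nabla>\<close> only
  differentiates along \<open>x\<^sub>3\<close>, where nothing varies, and the buoyancy \<open>\<theta> e\<^sub>3\<close> equals \<open>v\<^sub>t\<close>.
  It starts at rest, and \<open>g = 2 \<lambda> cos x\<^sub>1\<close> is large at \<open>x\<^sub>1 = 0\<close> and vanishes at \<open>x\<^sub>1 = \<pi>/2\<close>.
\<close>

section \<open>Integrals of directional derivatives over boxes\<close>

text \<open>Fubini: Lebesgue measure is the image of a product of one-dimensional measures, and
  integrating the coordinate along \<open>b\<close> first leaves an integral over a line parallel to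
  \<open>b\<close>.\<close>

lemma integral_lborel_eq_0_by_lines:
  fixes f :: "'a::euclidean_space \<Rightarrow> real"
  assumes b: "b \<in> Basis" and f: "integrable lborel f"
    and lines: "\<And>x. (LINT s|lborel. f (x + s *\<^sub>R b)) = 0"
  shows "(LINT x|lborel. f x) = 0"
proof -
  interpret product_sigma_finite "\<lambda>_::'a. lborel :: real measure" ..
  define T :: "('a \<Rightarrow> real) \<Rightarrow> 'a" where "T = (\<lambda>g. \<Sum>b\<in>Basis. g b *\<^sub>R b)"
  have T[measurable]: "T \<in> measurable (\<Pi>\<^sub>M b\<in>Basis. lborel) borel"
    unfolding T_def by measurable
  have lb: "(lborel :: 'a measure) = distr (\<Pi>\<^sub>M b\<in>Basis. lborel) borel T"
    unfolding T_def by (rule lborel_eq)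
  have [measurable]: "f \<in> borel_measurable borel"
    using f by (simp add: borel_measurable_integrable)
  have Basis: "Basis = insert b (Basis - {b})" using b by auto
  have int: "integrable (\<Pi>\<^sub>M b\<in>Basis. lborel) (\<lambda>g. f (T g))"
    using f unfolding lb by (simp add: integrable_distr_eq)
  \<comment> \<open>Changing the coordinate \<open>b\<close> moves the point along a line in
    direction \<open>b\<close>; the point with that coordinate set to 0 serves as base
    point.\<close>
  have upd: "T (g(b := y)) = T (g(b := 0)) + y *\<^sub>R b" for g y
  proof -
    have "T (g(b := y)) = y *\<^sub>R b + (\<Sum>c\<in>Basis - {b}. g c *\<^sub>R c)" for y
      unfolding T_def using b by (subst sum.remove[of _ b]) auto
    from this[of y] this[of 0] show ?thesis by simp
  qed
  have "(LINT x|lborel. f x) = (LINT g|(\<Pi>\<^sub>M b\<in>Basis. lborel). f (T g))"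
    unfolding lb by (simp add: integral_distr)
  also have "\<dots> = (LINT g|(\<Pi>\<^sub>M b\<in>Basis - {b}. lborel). (LINT y|lborel. f (T (g(b := y)))))"
    using product_integral_insert[of "Basis - {b}" b "\<lambda>g. f (T g)"] int Basis[symmetric] by simp
  also have "\<dots> = 0"
    by (subst upd) (simp add: lines)
  finally show ?thesis .
qed

lemma integrable_indicator_cbox:
  fixes f :: "'a::euclidean_space \<Rightarrow> real"
  assumes "continuous_on UNIV f"
  shows "integrable lborel (\<lambda>x. indicator (cbox l u) x * f x)"
  using borel_integrable_compact[of "cbox l u" f] continuous_on_subset[OF assms]
  by (simp add: compact_cbox)

text \<open>A line parallel to \<open>b\<close> meets the box in a segment or not at all. On a
  segment the fundamental theorem of calculus gives the difference of \<open>F\<close> at opposite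
  faces, and \<open>faces\<close> cancels it. This form covers both periodicity in space and
  vanishing at the initial and final times.\<close>

lemma integral_cbox_derivative_eq_0:
  fixes F f :: "'a::euclidean_space \<Rightarrow> real"
  assumes b: "b \<in> Basis" and f: "continuous_on UNIV f" and le: "l \<bullet> b \<le> u \<bullet> b"
    and F: "\<And>x s. ((\<lambda>s. F (x + s *\<^sub>R b)) has_real_derivative f (x + s *\<^sub>R b)) (at s)"
    and faces: "\<And>x. x \<bullet> b = l \<bullet> b \<Longrightarrow> F (x + ((u - l) \<bullet> b) *\<^sub>R b) = F x"
  shows "(LINT x|lborel. indicator (cbox l u) x * f x) = 0"
proof (rule integral_lborel_eq_0_by_lines[OF b integrable_indicator_cbox[OF f]])
  fix x
  show "(LINT s|lborel. indicator (cbox l u) (x + s *\<^sub>R b) * f (x + s *\<^sub>R b)) = 0"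
  proof (cases "\<forall>c\<in>Basis - {b}. l \<bullet> c \<le> x \<bullet> c \<and> x \<bullet> c \<le> u \<bullet> c")
    case True
    \<comment> \<open>These are the parameters at which the line crosses the lower and the upper
      face.\<close>
    let ?p = "l \<bullet> b - x \<bullet> b" and ?q = "u \<bullet> b - x \<bullet> b"
    have mem: "x + s *\<^sub>R b \<in> cbox l u \<longleftrightarrow> s \<in> {?p..?q}" for s
    proof -
      have "x + s *\<^sub>R b \<in> cbox l u \<longleftrightarrow>
        (\<forall>c\<in>insert b (Basis - {b}). l \<bullet> c \<le> (x + s *\<^sub>R b) \<bullet> c \<and> (x + s *\<^sub>R b) \<bullet> c \<le> u \<bullet> c)"
        using b by (simp add: mem_box insert_absorb)
      also have "\<dots> \<longleftrightarrow> s \<in> {?p..?q}"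
        using True b by (auto simp: inner_add_left inner_Basis)
      finally show ?thesis .
    qed
    have "(LINT s|lborel. indicator (cbox l u) (x + s *\<^sub>R b) * f (x + s *\<^sub>R b))
        = (LINT s|lborel. indicator {?p..?q} s *\<^sub>R f (x + s *\<^sub>R b))"
      by (intro Bochner_Integration.integral_cong refl) (simp add: indicator_def mem del: atLeastAtMost_iff)
    also have "\<dots> = F (x + ?q *\<^sub>R b) - F (x + ?p *\<^sub>R b)"
    proof (rule integral_FTC_atLeastAtMost)
      show "continuous_on {?p..?q} (\<lambda>s. f (x + s *\<^sub>R b))"
        by (intro continuous_on_compose2[OF f] continuous_intros) auto
    qed (use le F in \<open>auto simp: has_real_derivative_iff_has_vector_derivative
           intro: has_vector_derivative_at_within\<close>)
    also have "\<dots> = 0"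
    proof -
      have "x + ?q *\<^sub>R b = (x + ?p *\<^sub>R b) + ((u - l) \<bullet> b) *\<^sub>R b"
        by (simp add: inner_diff_left algebra_simps)
      with faces[of "x + ?p *\<^sub>R b"] b show ?thesis by (simp add: inner_add_left add.assoc)
    qed
    finally show ?thesis .
  next
    \<comment> \<open>A coordinate other than \<open>b\<close> is constant along the line, so one
      that is out of range keeps the whole line outside the box.\<close>
    case False
    then obtain c where c: "c \<in> Basis" "c \<noteq> b" "\<not> (l \<bullet> c \<le> x \<bullet> c \<and> x \<bullet> c \<le> u \<bullet> c)" by auto
    have "x + s *\<^sub>R b \<notin> cbox l u" for s
    proof -
      have "(x + s *\<^sub>R b) \<bullet> c = x \<bullet> c" using b c by (simp add: inner_add_left inner_Basis)
      then show ?thesis using c by (force simp: mem_box)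
    qed
    then show ?thesis by simp
  qed
qed

section \<open>Space-time integrals as integrals over a four-dimensional box\<close>

lemma T3_eq_cbox: "T3 = cbox 0 (\<chi> i. 2 * pi)"
  by (auto simp: T3_def mem_box_cart)

abbreviation spacetime_box :: "((real ^ 3) \<times> real) set" where
  "spacetime_box \<equiv> cbox (0, 0) (\<chi> i. 2 * pi, 1)"

text \<open>Fubini turns the iterated integral into a single one, so that space and time directions
  can be treated alike by \<open>integral_cbox_derivative_eq_0\<close>.\<close>

lemma spacetime_integral_eq:
  assumes f: "continuous_on UNIV f"
  shows "spacetime_integral f = (LINT z|lborel. indicator spacetime_box z * f z)"
proof -
  let ?g = "\<lambda>z. indicator spacetime_box z * f z"
  have int: "integrable (lborel \<Otimes>\<^sub>M lborel) ?g"
    using integrable_indicator_cbox[OF f] by (simp add: lborel_prod)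
  have "(LINT z|lborel. ?g z) = (LINT t|lborel. (LINT x|lborel. ?g (x, t)))"
    using lborel_pair.integral_snd[where f = "\<lambda>x t. ?g (x, t)"] int
    by (simp add: lborel_prod case_prod_unfold)
  also have "\<dots> = spacetime_integral f"
    unfolding spacetime_integral_def set_lebesgue_integral_def T3_eq_cbox cbox_Pair_eq
    by (auto intro!: Bochner_Integration.integral_cong simp: indicator_times indicator_def)
  finally show ?thesis by simp
qed

lemma spacetime_integral_add:
  assumes "continuous_on UNIV f" "continuous_on UNIV g"
  shows "spacetime_integral (\<lambda>z. f z + g z) = spacetime_integral f + spacetime_integral g"
  using assms
  by (simp add: spacetime_integral_eq continuous_on_add integrable_indicator_cbox distrib_left)

section \<open>Partial derivatives through the space-time derivative\<close>

lemma smooth_derivative: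
  assumes "smooth f"
  shows "(f has_derivative frechet_derivative f (at z)) (at z)"
    and "b \<in> Basis \<Longrightarrow> continuous_on UNIV (\<lambda>z. frechet_derivative f (at z) b)"
proof -
  have "C_k 1 f" using assms unfolding smooth_def by blast
  then have d: "f differentiable_on UNIV"
    and c: "b \<in> Basis \<Longrightarrow> continuous_on UNIV (\<lambda>z. frechet_derivative f (at z) b)"
    by auto
  show "(f has_derivative frechet_derivative f (at z)) (at z)"
    using d by (simp add: differentiable_on_def frechet_derivative_works)
  show "b \<in> Basis \<Longrightarrow> continuous_on UNIV (\<lambda>z. frechet_derivative f (at z) b)" by (fact c)
qed

lemma line_derivative:
  assumes "(f has_derivative f') (at (x + s *\<^sub>R b))"
  shows "((\<lambda>s. f (x + s *\<^sub>R b)) has_vector_derivative f' b) (at s)"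
proof -
  have "((\<lambda>s. f (x + s *\<^sub>R b)) has_derivative (\<lambda>h. f' (h *\<^sub>R b))) (at s)"
  proof (rule has_derivative_compose[where g = f and g' = f'])
    show "((\<lambda>s. x + s *\<^sub>R b) has_derivative (\<lambda>h. h *\<^sub>R b)) (at s)"
      by (auto intro!: derivative_eq_intros)
  qed (fact assms)
  then show ?thesis
    using linear_scale[OF has_derivative_linear[OF assms]]
    by (simp add: has_vector_derivative_def)
qed

text \<open>The time derivative is taken along a line in direction \<open>(0, 1)\<close>. Together
  with \<open>grad_nth\<close> and \<open>Grad_nth\<close> this writes every derivative in the weak
  formulation as a value of one Frechet derivative at a basis vector.\<close>

lemma dt_eq_frechet_derivative:
  assumes "(f has_derivative f') (at z)"
  shows "dt f z = f' (0, 1)"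
proof (cases z)
  case (Pair x t)
  have "((\<lambda>s. f ((x, 0) + s *\<^sub>R (0, 1))) has_vector_derivative f' (0, 1)) (at t)"
    using assms Pair by (intro line_derivative) simp
  then show ?thesis by (simp add: dt_def Pair vector_derivative_at)
qed

text \<open>Chain rule: freezing the time is composition with an affine map whose linear part sends
  \<open>h\<close> to \<open>(h, 0)\<close>.\<close>

lemma space_frechet_derivative:
  assumes "(f has_derivative f') (at (x, t))"
  shows "frechet_derivative (\<lambda>y. f (y, t)) (at x) = (\<lambda>h. f' (h, 0))"
proof -
  have "((\<lambda>y. f (y, t)) has_derivative (\<lambda>h. f' (h, 0))) (at x)"
  proof (rule has_derivative_compose[where g = f and g' = f'])
    show "((\<lambda>y. (y, t)) has_derivative (\<lambda>h. (h, 0))) (at x)"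
      by (intro has_derivative_Pair has_derivative_ident has_derivative_const)
  qed (fact assms)
  then show ?thesis by (rule frechet_derivative_at[symmetric])
qed

lemma grad_nth:
  assumes "(f has_derivative f') (at z)"
  shows "grad f z $ i = f' (axis i 1, 0)"
  using assms by (cases z) (simp add: grad_def space_frechet_derivative)

lemma Grad_nth:
  assumes "(f has_derivative f') (at z)"
  shows "Grad f z $ i $ j = f' (axis j 1, 0) $ i"
  using assms by (cases z) (simp add: Grad_def jacobian_def matrix_def space_frechet_derivative)

lemma inner_e3: "e3 \<bullet> x = x $ 3" "x \<bullet> e3 = x $ 3"
  by (simp_all add: e3_def inner_axis inner_axis')

text \<open>The only nonzero entry of the tensor is the one at \<open>(3, 3)\<close>, so the
  convection term sees only the derivative of the third component along the third axis.\<close>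

lemma inner_tensor_e3: "A \<bullet> tensor (c *\<^sub>R e3) (c *\<^sub>R e3) = c\<^sup>2 * A $ 3 $ 3"
  by (simp add: inner_vec_def sum_3 tensor_def e3_def axis_def power2_eq_square)

lemma continuous_on_fun_pair: "continuous_on UNIV g \<Longrightarrow> continuous_on A (\<lambda>z. g (fst z))"
  using continuous_on_compose2[OF _ continuous_on_fst[OF continuous_on_id]] by blast

section \<open>Integration by parts against test functions\<close>

text \<open>The properties of a test function that enter the integrations by parts. The derivative
  \<open>P'\<close> is a parameter so that the locale fits scalar test functions as well as
  components of vector-valued ones.\<close>

locale scalar_test_function =
  fixes P :: "(real ^ 3) \<times> real \<Rightarrow> real"
    and P' :: "(real ^ 3) \<times> real \<Rightarrow> (real ^ 3) \<times> real \<Rightarrow> real"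
  assumes P: "\<And>z. (P has_derivative P' z) (at z)"
    and P': "\<And>b. b \<in> Basis \<Longrightarrow> continuous_on UNIV (\<lambda>z. P' z b)"
    and periodic: "\<And>t. torus_periodic (\<lambda>x. P (x, t))"
    and boundary: "\<And>x. P (x, 0) = 0" "\<And>x. P (x, 1) = 0"
begin

lemma cont: "continuous_on UNIV P"
  using P by (meson differentiableI differentiable_imp_continuous_within continuous_at_imp_continuous_on)

lemma line: "((\<lambda>s. P (x + s *\<^sub>R b)) has_real_derivative P' (x + s *\<^sub>R b) b) (at s)"
  using line_derivative[OF P] by (simp add: has_real_derivative_iff_has_vector_derivative)

text \<open>Since \<open>c\<close> is constant along the third axis, the integrand is the derivative
  of \<open>c z * P z\<close> in that direction, and periodicity makes the values at opposite faces
  agree. This removes all transport terms.\<close>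

lemma spacetime_integral_dx3:
  fixes c :: "(real ^ 3) \<times> real \<Rightarrow> real"
  assumes c: "continuous_on UNIV c" "\<And>z s. c (z + s *\<^sub>R (axis 3 1, 0)) = c z"
  shows "spacetime_integral (\<lambda>z. c z * P' z (axis 3 1, 0)) = 0"
proof -
  let ?b = "(axis 3 1, 0) :: (real ^ 3) \<times> real"
  have b: "?b \<in> Basis" by (auto simp: Basis_prod_def)
  have cont: "continuous_on UNIV (\<lambda>z. c z * P' z ?b)" by (intro continuous_intros c P' b)
  show ?thesis unfolding spacetime_integral_eq[OF cont]
  proof (rule integral_cbox_derivative_eq_0[OF b cont, where F = "\<lambda>z. c z * P z"])
    fix z s
    show "((\<lambda>s. c (z + s *\<^sub>R ?b) * P (z + s *\<^sub>R ?b)) has_real_derivative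
        c (z + s *\<^sub>R ?b) * P' (z + s *\<^sub>R ?b) ?b) (at s)"
      unfolding c(2) by (rule DERIV_cmult[OF line])
  next
    fix z :: "(real ^ 3) \<times> real"
    \<comment> \<open>The edge of the box along the third axis is exactly one period.\<close>
    have "P (z + (2 * pi) *\<^sub>R ?b) = P z"
    proof -
      have "(2 * pi) *\<^sub>R axis 3 1 = (axis 3 (2 * pi) :: real ^ 3)"
        by (simp add: vec_eq_iff axis_def)
      then show ?thesis
        using periodic[of "snd z"] by (cases z) (simp add: torus_periodic_def)
    qed
    then show "c (z + (((\<chi> i. 2 * pi, 1) - (0, 0)) \<bullet> ?b) *\<^sub>R ?b) *
      P (z + (((\<chi> i. 2 * pi, 1) - (0, 0)) \<bullet> ?b) *\<^sub>R ?b) = c z * P z"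
      by (simp add: c(2)[of z, simplified] inner_axis)
  qed (simp add: inner_axis)
qed

text \<open>Both integrands are total time derivatives, of \<open>g * t * P\<close> and of
  \<open>g * P\<close>, with \<open>P\<close> zero at times 0 and 1. The first serves the momentum
  equation, where inertia and buoyancy combine; the second serves the temperature equation.\<close>

lemma spacetime_integral_dt:
  assumes g: "continuous_on UNIV g"
  shows "spacetime_integral (\<lambda>z. g (fst z) * (P z + snd z * P' z (0, 1))) = 0"
    and "spacetime_integral (\<lambda>z. g (fst z) * P' z (0, 1)) = 0"
proof -
  let ?b = "(0, 1) :: (real ^ 3) \<times> real"
  have b: "?b \<in> Basis" by (auto simp: Basis_prod_def)
  note [continuous_intros] = continuous_on_fun_pair[OF g] P'[OF b] cont
  have cont: "continuous_on UNIV (\<lambda>z. g (fst z) * (P z + snd z * P' z ?b))" by (intro continuous_intros)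
  show "spacetime_integral (\<lambda>z. g (fst z) * (P z + snd z * P' z (0, 1))) = 0"
    unfolding spacetime_integral_eq[OF cont]
  proof (rule integral_cbox_derivative_eq_0[OF b cont, where F = "\<lambda>z. g (fst z) * (snd z * P z)"])
    fix z s
    show "((\<lambda>s. g (fst (z + s *\<^sub>R ?b)) * (snd (z + s *\<^sub>R ?b) * P (z + s *\<^sub>R ?b))) has_real_derivative
        g (fst (z + s *\<^sub>R ?b)) * (P (z + s *\<^sub>R ?b) + snd (z + s *\<^sub>R ?b) * P' (z + s *\<^sub>R ?b) ?b)) (at s)"
      using line[of z ?b s] by (auto intro!: derivative_eq_intros simp: algebra_simps)
  next
    fix z :: "(real ^ 3) \<times> real" assume "z \<bullet> ?b = (0, 0) \<bullet> ?b"
    then show "g (fst (z + (((\<chi> i. 2 * pi, 1) - (0, 0)) \<bullet> ?b) *\<^sub>R ?b)) *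
       (snd (z + (((\<chi> i. 2 * pi, 1) - (0, 0)) \<bullet> ?b) *\<^sub>R ?b) * P (z + (((\<chi> i. 2 * pi, 1) - (0, 0)) \<bullet> ?b) *\<^sub>R ?b))
       = g (fst z) * (snd z * P z)"
      by (cases z) (simp add: boundary)
  qed simp
  have cont: "continuous_on UNIV (\<lambda>z. g (fst z) * P' z ?b)" by (intro continuous_intros)
  show "spacetime_integral (\<lambda>z. g (fst z) * P' z (0, 1)) = 0"
    unfolding spacetime_integral_eq[OF cont]
  proof (rule integral_cbox_derivative_eq_0[OF b cont, where F = "\<lambda>z. g (fst z) * P z"])
    fix z s
    show "((\<lambda>s. g (fst (z + s *\<^sub>R ?b)) * P (z + s *\<^sub>R ?b)) has_real_derivative
        g (fst (z + s *\<^sub>R ?b)) * P' (z + s *\<^sub>R ?b) ?b) (at s)"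
      using DERIV_cmult[OF line[of z ?b s]] by simp
  next
    fix z :: "(real ^ 3) \<times> real" assume "z \<bullet> ?b = (0, 0) \<bullet> ?b"
    then show "g (fst (z + (((\<chi> i. 2 * pi, 1) - (0, 0)) \<bullet> ?b) *\<^sub>R ?b)) *
        P (z + (((\<chi> i. 2 * pi, 1) - (0, 0)) \<bullet> ?b) *\<^sub>R ?b) = g (fst z) * P z"
      by (cases z) (simp add: boundary)
  qed simp
qed

end

lemma test_function_boundary:
  assumes "test_function f"
  shows "f (x, 0) = 0" "f (x, 1) = 0"
proof -
  obtain a b where "0 < a" "b < 1" and out: "\<And>x t. t \<notin> {a..b} \<Longrightarrow> f (x, t) = 0"
    using assms unfolding test_function_def by blast
  then show "f (x, 0) = 0" "f (x, 1) = 0" by (auto intro!: out)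
qed

lemma test_function_scalar:
  assumes "test_function f"
  shows "scalar_test_function f (\<lambda>z. frechet_derivative f (at z))"
proof -
  have f: "smooth f" "\<And>t. torus_periodic (\<lambda>x. f (x, t))"
    using assms by (auto simp: test_function_def)
  show ?thesis
    by (rule scalar_test_function.intro)
      (fact smooth_derivative[OF f(1)] f(2) test_function_boundary[OF assms])+
qed

text \<open>Taking a coordinate is bounded and linear, hence commutes with differentiation. The
  momentum equation is tested through the third component.\<close>

lemma test_function_nth:
  fixes f :: "(real ^ 3) \<times> real \<Rightarrow> real ^ 3"
  assumes "test_function f"
  shows "scalar_test_function (\<lambda>z. f z $ i) (\<lambda>z h. frechet_derivative f (at z) h $ i)"
proof -
  have f: "smooth f" "\<And>t. torus_periodic (\<lambda>x. f (x, t))"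
    using assms by (auto simp: test_function_def)
  show ?thesis
  proof (rule scalar_test_function.intro)
    show "((\<lambda>z. f z $ i) has_derivative (\<lambda>h. frechet_derivative f (at z) h $ i)) (at z)" for z
      by (rule bounded_linear.has_derivative[OF bounded_linear_vec_nth smooth_derivative(1)[OF f(1)]])
    show "continuous_on UNIV (\<lambda>z. frechet_derivative f (at z) b $ i)" if "b \<in> Basis" for b
      by (intro bounded_linear.continuous_on[OF bounded_linear_vec_nth] smooth_derivative(2)[OF f(1) that])
    show "torus_periodic (\<lambda>x. f (x, t) $ i)" for t
      using f(2) by (simp add: torus_periodic_def)
  qed (simp_all add: test_function_boundary[OF assms])
qed

section \<open>Vertical shear flows as exact solutions\<close>

theorem boussinesq_solution_vertical_shear:
  fixes g :: "real ^ 3 \<Rightarrow> real"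
  assumes g: "continuous_on UNIV g" and g3: "\<And>x s. g (x + s *\<^sub>R axis 3 1) = g x"
  shows "boussinesq_solution (\<lambda>_. 0) (\<lambda>z. (snd z * g (fst z)) *\<^sub>R e3) (\<lambda>_. 0) (\<lambda>z. g (fst z))"
proof -
  note [continuous_intros] = continuous_on_fun_pair[OF g]
  let ?b = "(axis 3 1, 0) :: (real ^ 3) \<times> real"
  have B: "?b \<in> Basis" "(0, 1 :: real) \<in> (Basis :: ((real ^ 3) \<times> real) set)"
    by (auto simp: Basis_prod_def)
  have "spacetime_integral (\<lambda>z. dt \<phi> z \<bullet> ((snd z * g (fst z)) *\<^sub>R e3)
      + Grad \<phi> z \<bullet> tensor ((snd z * g (fst z)) *\<^sub>R e3) ((snd z * g (fst z)) *\<^sub>R e3)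
      + 0 * divergence \<phi> z + (g (fst z) *\<^sub>R e3) \<bullet> \<phi> z) = 0"
    if "test_function \<phi>" for \<phi> :: "(real ^ 3) \<times> real \<Rightarrow> real ^ 3"
  proof -
    let ?D = "\<lambda>z. frechet_derivative \<phi> (at z)"
    interpret scalar_test_function "\<lambda>z. \<phi> z $ 3" "\<lambda>z h. ?D z h $ 3"
      by (rule test_function_nth[OF that])
    have D: "(\<phi> has_derivative ?D z) (at z)" for z
      using that smooth_derivative(1) by (auto simp: test_function_def)
    \<comment> \<open>With velocity \<open>t * g\<close> along \<open>e3\<close>, inertia and
      buoyancy form the time derivative of \<open>t * g\<close> times the third component of the
      test function; convection leaves a derivative along the third axis with coefficient
      \<open>(t * g)^2\<close>.\<close>
    have "spacetime_integral (\<lambda>z. dt \<phi> z \<bullet> ((snd z * g (fst z)) *\<^sub>R e3)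
        + Grad \<phi> z \<bullet> tensor ((snd z * g (fst z)) *\<^sub>R e3) ((snd z * g (fst z)) *\<^sub>R e3)
        + 0 * divergence \<phi> z + (g (fst z) *\<^sub>R e3) \<bullet> \<phi> z)
      = spacetime_integral (\<lambda>z. g (fst z) * (\<phi> z $ 3 + snd z * ?D z (0, 1) $ 3)
          + (snd z * g (fst z))\<^sup>2 * ?D z ?b $ 3)"
      by (intro arg_cong[where f = spacetime_integral] ext)
        (simp add: inner_e3 inner_tensor_e3 dt_eq_frechet_derivative[OF D] Grad_nth[OF D] algebra_simps)
    also have "\<dots> = 0"
    proof (subst spacetime_integral_add)
      have "spacetime_integral (\<lambda>z. (snd z * g (fst z))\<^sup>2 * ?D z ?b $ 3) = 0"
        by (rule spacetime_integral_dx3) (auto intro!: continuous_intros simp: g3)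
      then show "spacetime_integral (\<lambda>z. g (fst z) * (\<phi> z $ 3 + snd z * ?D z (0, 1) $ 3))
          + spacetime_integral (\<lambda>z. (snd z * g (fst z))\<^sup>2 * ?D z ?b $ 3) = 0"
        by (simp add: spacetime_integral_dt[OF g])
    qed (intro continuous_intros cont P'[OF B(1)] P'[OF B(2)])+
    finally show ?thesis .
  qed
  moreover have "spacetime_integral (\<lambda>z. dt \<phi> z * g (fst z)
      + (((snd z * g (fst z)) *\<^sub>R e3) \<bullet> grad \<phi> z) * g (fst z) + 0 * \<phi> z) = 0"
    and "spacetime_integral (\<lambda>z. ((snd z * g (fst z)) *\<^sub>R e3) \<bullet> grad \<phi> z) = 0"
    if "test_function \<phi>" for \<phi> :: "(real ^ 3) \<times> real \<Rightarrow> real"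
  proof -
    let ?D = "\<lambda>z. frechet_derivative \<phi> (at z)"
    interpret scalar_test_function \<phi> ?D
      by (rule test_function_scalar[OF that])
    \<comment> \<open>The transport term becomes a derivative along the third axis with coefficient
      \<open>t * g^2\<close>, again constant in that direction.\<close>
    have "spacetime_integral (\<lambda>z. dt \<phi> z * g (fst z)
        + (((snd z * g (fst z)) *\<^sub>R e3) \<bullet> grad \<phi> z) * g (fst z) + 0 * \<phi> z)
      = spacetime_integral (\<lambda>z. g (fst z) * ?D z (0, 1) + (snd z * (g (fst z))\<^sup>2) * ?D z ?b)"
      by (intro arg_cong[where f = spacetime_integral] ext)
        (simp add: inner_e3 dt_eq_frechet_derivative[OF P] grad_nth[OF P] algebra_simps power2_eq_square)
    also have "\<dots> = 0"
    proof (subst spacetime_integral_add)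
      have "spacetime_integral (\<lambda>z. (snd z * (g (fst z))\<^sup>2) * ?D z ?b) = 0"
        by (rule spacetime_integral_dx3) (auto intro!: continuous_intros simp: g3)
      then show "spacetime_integral (\<lambda>z. g (fst z) * ?D z (0, 1))
          + spacetime_integral (\<lambda>z. (snd z * (g (fst z))\<^sup>2) * ?D z ?b) = 0"
        by (simp add: spacetime_integral_dt[OF g])
    qed (intro continuous_intros P'[OF B(1)] P'[OF B(2)])+
    finally show "spacetime_integral (\<lambda>z. dt \<phi> z * g (fst z)
        + (((snd z * g (fst z)) *\<^sub>R e3) \<bullet> grad \<phi> z) * g (fst z) + 0 * \<phi> z) = 0" .
    show "spacetime_integral (\<lambda>z. ((snd z * g (fst z)) *\<^sub>R e3) \<bullet> grad \<phi> z) = 0"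
      \<comment> \<open>Incompressibility is the same cancellation with coefficient
        \<open>t * g\<close>.\<close>
      unfolding inner_scaleR_left inner_e3 grad_nth[OF P]
      by (rule spacetime_integral_dx3) (auto intro!: continuous_intros simp: g3)
  qed
  ultimately show ?thesis unfolding boussinesq_solution_def by blast
qed

section \<open>Lower bound for the temperature\<close>

text \<open>As \<open>pi / 3 > 1\<close>, monotonicity of the cosine gives at least
  \<open>cos (pi / 3) = 1 / 2\<close> on the unit interval.\<close>

lemma cos_square_ge: "1 / 4 \<le> (cos x)\<^sup>2" if "0 \<le> x" "x \<le> 1" for x :: real
proof -
  have "cos (pi / 3) \<le> cos x" using that pi_gt3 by (intro cos_monotone_0_pi_le) auto
  then have "(1 / 2)\<^sup>2 \<le> (cos x)\<^sup>2" by (intro power_mono) (auto simp: cos_60)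
  then show ?thesis by (simp add: power2_eq_square)
qed

text \<open>The integrand is nonnegative, so the integral may be restricted to the unit box, which
  has measure 1 and where \<open>cos_square_ge\<close> applies.\<close>

lemma spacetime_integral_cos_square_ge:
  "spacetime_integral (\<lambda>z. (A * cos (fst z $ 1))\<^sup>2) \<ge> A\<^sup>2 / 4"
proof -
  let ?Q = "cbox (0, 0) (\<chi> i. 1, 1) :: ((real ^ 3) \<times> real) set"
  have sub: "?Q \<subseteq> spacetime_box"
  proof -
    have "y \<le> 1 \<Longrightarrow> y \<le> 2 * pi" for y :: real using pi_gt3 by simp
    then show ?thesis by (auto simp: cbox_Pair_eq mem_box_cart)
  qed
  have "measure lborel (cbox 0 (\<chi> i. 1) :: (real ^ 3) set) = 1"
    by (subst content_cbox_cart) (auto simp: interval_ne_empty_cart)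
  then have Q: "measure lborel ?Q = 1" by (simp add: content_Pair)
  have cont: "continuous_on UNIV (\<lambda>z :: (real ^ 3) \<times> real. (A * cos (fst z $ 1))\<^sup>2)"
    by (intro continuous_intros)
  have "A\<^sup>2 / 4 = (LINT z|lborel. indicator ?Q z * (A\<^sup>2 / 4))"
    using Q by simp
  also have "\<dots> \<le> (LINT z|lborel. indicator spacetime_box z * (A * cos (fst z $ 1))\<^sup>2)"
  proof (intro integral_mono integrable_indicator_cbox cont continuous_on_const)
    fix z :: "(real ^ 3) \<times> real"
    show "indicator ?Q z * (A\<^sup>2 / 4) \<le> indicator spacetime_box z * (A * cos (fst z $ 1))\<^sup>2"
    proof (cases "z \<in> ?Q")
      case True
      then have "1 / 4 \<le> (cos (fst z $ 1))\<^sup>2"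
        by (intro cos_square_ge) (auto simp: cbox_Pair_eq mem_box_cart)
      then have "A\<^sup>2 * (1 / 4) \<le> A\<^sup>2 * (cos (fst z $ 1))\<^sup>2" by (intro mult_left_mono) auto
      then show ?thesis using True sub by (auto simp: power_mult_distrib)
    qed (simp add: indicator_def)
  qed
  finally show ?thesis by (simp add: spacetime_integral_eq[OF cont])
qed

section \<open>Choice of the shear profile and the required bounds\<close>

theorem theorem1p3:
  fixes M lam :: real
  assumes "M > 0" and "lam > 0"
  shows "\<exists>(v :: (real ^ 3) \<times> real \<Rightarrow> real ^ 3) (p :: (real ^ 3) \<times> real \<Rightarrow> real)
            (\<theta> :: (real ^ 3) \<times> real \<Rightarrow> real).
           continuous_T3 v \<and> continuous_T3 p \<and> continuous_T3 \<theta> \<and>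
           boussinesq_solution (\<lambda>_. 0) v p \<theta> \<and>
           (SUP x\<in>T3. norm (v (x, 0))) \<le> 4 * M \<and>
           spacetime_integral (\<lambda>z. \<bar>\<theta> z\<bar>\<^sup>2) \<ge> lam\<^sup>2 \<and>
           (\<forall>t\<in>{1/2..1}. (SUP x\<in>T3. norm (v (x, t))) \<ge> lam \<and>
                          (INF x\<in>T3. norm (v (x, t))) \<le> 4 * M)"
proof -
  \<comment> \<open>The amplitude \<open>2 * lam\<close> compensates both the factor
    \<open>t\<close>, which is at least 1/2 on the final time interval, and the factor 1/4 in the
    bound for the squared temperature.\<close>
  define g :: "real ^ 3 \<Rightarrow> real" where "g = (\<lambda>x. (2 * lam) * cos (x $ 1))"
  define v :: "(real ^ 3) \<times> real \<Rightarrow> real ^ 3" where "v = (\<lambda>z. (snd z * g (fst z)) *\<^sub>R e3)"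
  have g: "continuous_on UNIV g" unfolding g_def by (intro continuous_intros)
  note [continuous_intros] = continuous_on_fun_pair[OF g]
  have per: "g (x + axis i (2 * pi)) = g x" for x i
    by (cases "i = 1") (auto simp: g_def axis_def)
  have v: "norm (v (x, t)) = \<bar>t\<bar> * \<bar>g x\<bar>" for x t
    by (simp add: v_def e3_def abs_mult)
  \<comment> \<open>At the first point the cosine is 1, at the second it is 0; they witness the
    bounds on the supremum and the infimum.\<close>
  have T3: "0 \<in> T3" "(\<chi> i. pi / 2) \<in> T3" by (auto simp: T3_def)
  have "continuous_T3 v" "continuous_T3 (\<lambda>_. 0 :: real)" "continuous_T3 (\<lambda>z. g (fst z))"
    by (auto simp: continuous_T3_def torus_periodic_def v_def per intro!: continuous_intros)
  moreover have "boussinesq_solution (\<lambda>_. 0) v (\<lambda>_. 0) (\<lambda>z. g (fst z))"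
    unfolding v_def using g
    by (rule boussinesq_solution_vertical_shear) (simp add: g_def axis_def)
  moreover have "(SUP x\<in>T3. norm (v (x, 0))) \<le> 4 * M"
    using assms T3 by (intro cSUP_least) (auto simp: v)
  moreover have "spacetime_integral (\<lambda>z. \<bar>g (fst z)\<bar>\<^sup>2) \<ge> lam\<^sup>2"
    using spacetime_integral_cos_square_ge[of "2 * lam"] by (simp add: g_def power_mult_distrib)
  moreover have "(SUP x\<in>T3. norm (v (x, t))) \<ge> lam" "(INF x\<in>T3. norm (v (x, t))) \<le> 4 * M"
    if t: "t \<in> {1/2..1}" for t
  proof -
    \<comment> \<open>A real supremum dominates the values only of a set that is bounded above, so
      an upper bound on the speed comes first.\<close>
    have "\<bar>t\<bar> * \<bar>g x\<bar> \<le> 1 * (2 * lam)" for x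
      using t assms by (intro mult_mono) (auto simp: g_def abs_mult)
    then have "bdd_above ((\<lambda>x. norm (v (x, t))) ` T3)"
      by (intro bdd_aboveI2[where M = "2 * lam"]) (simp add: v)
    moreover have "lam \<le> norm (v (0, t))"
      using t assms mult_right_mono[of "1/2" t "2 * lam"] by (simp add: v g_def)
    ultimately show "(SUP x\<in>T3. norm (v (x, t))) \<ge> lam"
      using T3 by (intro cSUP_upper2) auto
    \<comment> \<open>The fluid is at rest at this point at all times, and 0 is a lower bound for
      the speed.\<close>
    have "(INF x\<in>T3. norm (v (x, t))) \<le> norm (v (\<chi> i. pi / 2, t))"
      using T3 by (intro cINF_lower bdd_belowI2[where m = 0]) auto
    also have "\<dots> \<le> 4 * M" using assms by (simp add: v g_def)
    finally show "(INF x\<in>T3. norm (v (x, t))) \<le> 4 * M" .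
  qed
  ultimately show ?thesis by blast
qed

end
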